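(* Let $m,n,k\ge 1$ be integers, let $A\in\mathbb{Z}^{m\times n}$ and $b\in\mathbb{Z}^m$ satisfy $A_{ij}\ge 0$ and $b_i>0$ for all $i=1,\ldots,m$, $j=1,\ldots,n$, and let $Q=\{x\in\mathbb{R}^n : x\ge 0,\ Ax\ge b\}$. Then the $k$-aggregation closure $$\mathcal{A}_k(Q)=\bigcap_{\Lambda\in\mathbb{R}^{m\times k}_+}\operatorname{conv}\{Q^\Lambda\cap\mathbb{Z}^n\},\qquad Q^\Lambda=\{x\in\mathbb{R}^n : x\ge 0,\ \Lambda^TAx\ge\Lambda^Tb\},$$ is a polyhedron.
   Context: $\mathbb{R}^{m\times k}_+$ denotes the set of real $m\times k$ matrices with nonnegative entries (not necessarily rational); inequalities between vectors are componentwise; $\operatorname{conv}$ denotes convex hull. A polyhedron is an intersection of finitely many closed halfspaces of $\mathbb{R}^n$ (possibly empty). A covering integer program is one with feasible region $\{x\in\mathbb{Z}^n : x\ge0,\ Ax\ge b\}$ with $A,b$ as in the claim. *)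

theory Defs
  imports "HOL-Analysis.Analysis"
begin

text \<open>The order on vectors is the componentwise one, so both inequalities below are systems of
  scalar inequalities.\<close>

definition covering_polyhedron :: "real ^ 'n ^ 'm \<Rightarrow> real ^ 'm \<Rightarrow> (real ^ 'n) set" where
  "covering_polyhedron A b = {x. 0 \<le> x \<and> b \<le> A *v x}"

definition integer_points :: "(real ^ 'n) set" where
  "integer_points = {x. \<forall>j. x $ j \<in> \<int>}"

definition aggregated_polyhedron ::
  "real ^ 'n ^ 'm \<Rightarrow> real ^ 'm \<Rightarrow> real ^ 'k ^ 'm \<Rightarrow> (real ^ 'n) set" where
  "aggregated_polyhedron A b \<Lambda> =
     covering_polyhedron (transpose \<Lambda> ** A) (transpose \<Lambda> *v b)"

text \<open>The closure of \<open>Q = covering_polyhedron A b\<close> depends on the description \<open>(A, b)\<close> of \<open>Q\<close>,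
  which is therefore its argument. The number \<open>k\<close> of aggregated inequalities is \<open>CARD('k)\<close>; the
  type is passed explicitly because it occurs only in the bound variable \<open>\<Lambda>\<close>, which ranges
  over all \<open>m \<times> k\<close> real matrices with nonnegative entries.\<close>

definition aggregation_closure ::
  "'k::finite itself \<Rightarrow> real ^ 'n ^ 'm \<Rightarrow> real ^ 'm \<Rightarrow> (real ^ 'n) set" where
  "aggregation_closure _ A b =
     (\<Inter>\<Lambda> \<in> {\<Lambda> :: real ^ 'k ^ 'm. \<forall>i l. 0 \<le> \<Lambda> $ i $ l}.
        convex hull (aggregated_polyhedron A b \<Lambda> \<inter> integer_points))"

end

theory Submission
  imports Defs
begin

text \<open>The integer points of each \<open>Q\<^sup>\<Lambda>\<close> form an up-closed subset of \<open>\<nat>\<^sup>n\<close>, and for \<^emph>\<open>every\<close> family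
  \<open>\<F>\<close> of up-closed subsets of \<open>\<nat>\<^sup>n\<close> the intersection of the convex hulls is a polyhedron. Let \<open>L\<close> be
  the closure of \<open>\<F>\<close> in the product topology on the power set of \<open>\<nat>\<^sup>n\<close>. By Dickson's lemma each
  \<open>W \<in> L\<close> has finitely many minimal elements, so the sets containing these elements form an open
  neighbourhood of \<open>W\<close>, all of whose up-closed members contain \<open>W\<close>. By compactness finitely many
  \<open>W \<in> L\<close> suffice for every member of \<open>\<F>\<close> to contain one of them. No point of the intersection is
  lost on passing to these \<open>W\<close>: a point outside \<open>conv W\<close> is separated from it by a strictly positive
  functional, which is small at only finitely many points of \<open>\<nat>\<^sup>n\<close>, so the point is also outside
  \<open>conv V\<close> for each \<open>V \<in> \<F>\<close> that agrees with \<open>W\<close> at those points. Finally, \<open>conv W\<close> is a polytope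
  plus the nonnegative orthant.\<close>

section \<open>Compactness of the power set\<close>

text \<open>\<open>L\<close> is the closure of \<open>\<F>\<close>, the finite sets \<open>B\<close>
  giving the basic neighbourhoods. Since \<open>g W\<close> is finite, containing it is an open
  condition, and \<open>W\<close> itself satisfies it; compactness selects
  \<open>\<G>\<close>.\<close>

lemma finite_limit_cover:
  fixes \<F> :: "'a set set"
  defines "L \<equiv> {W. \<forall>B. finite B \<longrightarrow> (\<exists>V\<in>\<F>. V \<inter> B = W \<inter> B)}"
  assumes fin: "\<And>W. W \<in> L \<Longrightarrow> finite (g W)" and sub: "\<And>W. W \<in> L \<Longrightarrow> g W \<subseteq> W"
  shows "\<exists>\<G>. finite \<G> \<and> \<G> \<subseteq> L \<and> (\<forall>V\<in>\<F>. \<exists>W\<in>\<G>. g W \<subseteq> V)"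
proof -
  \<comment> \<open>Sets become indicator functions into the discrete space \<open>bool\<close>, so
    that Tychonoff's theorem applies.\<close>
  define \<X> where "\<X> = closure ((\<lambda>V x. x \<in> V) ` \<F>)"
  have "compact_space (euclidean :: bool topology)"
    by (simp add: compact_space_def finite_imp_compact)
  then have "compact_space (product_topology (\<lambda>_::'a. euclidean :: bool topology) UNIV)"
    using compact_space_product_topology by blast
  then have "compact (UNIV :: ('a \<Rightarrow> bool) set)"
    unfolding euclidean_product_topology compact_space_def by simp
  then have "compact \<X>"
    unfolding \<X>_def by (metis closed_closure compact_Int_closed inf_top_left)
  have limit: "Collect f \<in> L" if "f \<in> \<X>" for f
    unfolding L_def
  proof clarify
    fix B :: "'a set" assume "finite B"
    define U where "U = {h. \<forall>x\<in>B. h x \<in> {f x}}"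
    have "open U"
      unfolding U_def by (rule product_topology_basis'[OF \<open>finite B\<close> open_discrete])
    moreover have "f \<in> U" by (simp add: U_def)
    ultimately have "U \<inter> (\<lambda>V x. x \<in> V) ` \<F> \<noteq> {}"
      using that unfolding \<X>_def by (simp add: closure_iff_nhds_not_empty) blast
    then show "\<exists>V\<in>\<F>. V \<inter> B = Collect f \<inter> B"
      unfolding U_def by auto
  qed
  define N where "N W = {h. \<forall>x\<in>g W. h x \<in> {True}}" for W
  have "open (N W)" if "W \<in> L" for W
    unfolding N_def by (rule product_topology_basis'[OF fin[OF that] open_discrete])
  moreover have "\<X> \<subseteq> (\<Union>W\<in>L. N W)"
    using limit sub unfolding N_def by fastforce
  ultimately obtain \<G> where "\<G> \<subseteq> L" "finite \<G>" and cover: "\<X> \<subseteq> (\<Union>W\<in>\<G>. N W)"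
    using compactE_image[OF \<open>compact \<X>\<close>, of L N] by metis
  moreover have "\<exists>W\<in>\<G>. g W \<subseteq> V" if "V \<in> \<F>" for V
  proof -
    have "(\<lambda>x. x \<in> V) \<in> \<X>"
      using that closure_subset unfolding \<X>_def by fastforce
    then show ?thesis using cover unfolding N_def by blast
  qed
  ultimately show ?thesis by blast
qed

section \<open>Dickson's lemma\<close>

lemma nat_seq_monosub:
  fixes s :: "nat \<Rightarrow> nat"
  shows "\<exists>r::nat\<Rightarrow>nat. strict_mono r \<and> incseq (s \<circ> r)"
proof -
  obtain f where f: "strict_mono f" "monoseq (\<lambda>n. s (f n))"
    using seq_monosub by blast
  show ?thesis
  proof (cases "incseq (\<lambda>n. s (f n))")
    case True
    then show ?thesis using f by (auto simp: o_def)
  next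
    case False
    then have dec: "decseq (\<lambda>n. s (f n))" using f monoseq_iff by auto
    \<comment> \<open>A decreasing sequence of naturals is constant from the index \<open>k\<close>
      of its least value on, so shifting by \<open>k\<close> makes it increasing.\<close>
    define k where "k = (ARG_MIN (\<lambda>n. s (f n)) n. True)"
    have k: "s (f k) \<le> s (f n)" for n
      unfolding k_def using arg_min_nat_le by metis
    have "s (f (n + k)) = s (f k)" for n
      using k[of "n + k"] decseqD[OF dec, of k "n + k"] by simp
    moreover have "strict_mono (\<lambda>n. f (n + k))"
      using f(1) by (simp add: strict_mono_def)
    ultimately show ?thesis
      by (intro exI[of _ "\<lambda>n. f (n + k)"]) (auto simp: incseq_def)
  qed
qed

text \<open>Subsequences are extracted one coordinate at a time; coordinates treated earlier stay
  increasing under further thinning.\<close>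

lemma nat_fun_seq_monosub:
  fixes s :: "nat \<Rightarrow> 'i::finite \<Rightarrow> nat"
  shows "\<exists>r::nat\<Rightarrow>nat. strict_mono r \<and> incseq (s \<circ> r)"
proof -
  have "\<exists>r::nat\<Rightarrow>nat. strict_mono r \<and> (\<forall>i\<in>I. incseq (\<lambda>n. s (r n) i))" if "finite I" for I :: "'i set"
    using that
  proof induction
    case empty
    then show ?case using strict_mono_id by auto
  next
    case (insert j I)
    then obtain r where r: "strict_mono r" "\<And>i. i \<in> I \<Longrightarrow> incseq (\<lambda>n. s (r n) i)" by blast
    obtain q where q: "strict_mono q" "incseq ((\<lambda>n. s (r n) j) \<circ> q)"
      using nat_seq_monosub by blast
    have "incseq (\<lambda>n. s (r (q n)) i)" if "i \<in> insert j I" for i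
    proof (cases "i = j")
      case False
      then have "incseq (\<lambda>n. s (r n) i)" using r that by auto
      then show ?thesis
        using q(1) by (simp add: incseq_def strict_mono_less_eq)
    qed (use q in \<open>simp add: o_def\<close>)
    then show ?case
      using r(1) q(1) by (intro exI[of _ "r \<circ> q"]) (auto simp: strict_mono_def)
  qed
  from this[of UNIV] show ?thesis
    by (auto simp: incseq_def le_fun_def)
qed

text \<open>Infinitely many minimal elements would yield an increasing subsequence of distinct ones,
  yet two comparable minimal elements coincide.\<close>

lemma finite_minimal_nat_fun:
  fixes U :: "('i::finite \<Rightarrow> nat) set"
  shows "\<exists>M\<subseteq>U. finite M \<and> (\<forall>u\<in>U. \<exists>m\<in>M. m \<le> u)"
proof (intro exI conjI ballI)
  define M where "M = {m \<in> U. \<forall>u\<in>U. u \<le> m \<longrightarrow> u = m}"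
  show "M \<subseteq> U" by (auto simp: M_def)
  show "finite M"
  proof (rule ccontr)
    assume "infinite M"
    then obtain s :: "nat \<Rightarrow> 'i \<Rightarrow> nat" where s: "inj s" "range s \<subseteq> M"
      using infinite_countable_subset by blast
    obtain r :: "nat \<Rightarrow> nat" where r: "strict_mono r" "incseq (s \<circ> r)"
      using nat_fun_seq_monosub by blast
    have "s (r 0) \<le> s (r 1)" using incseqD[OF r(2), of 0 1] by simp
    then have "s (r 0) = s (r 1)" using s unfolding M_def by blast
    then have "r 0 = r 1" using s injD by metis
    then show False using r(1) by (simp add: strict_mono_eq)
  qed
  fix u assume "u \<in> U"
  \<comment> \<open>Below \<open>u\<close>, an element of least coordinate sum is minimal, because a
    strictly smaller one would have a smaller sum.\<close>
  define m where "m = (ARG_MIN (\<lambda>v. sum v UNIV) v. v \<in> U \<and> v \<le> u)"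
  have m: "m \<in> U" "m \<le> u" and min: "\<And>v. v \<in> U \<Longrightarrow> v \<le> u \<Longrightarrow> sum m UNIV \<le> sum v UNIV"
    using arg_min_nat_lemma[of "\<lambda>v. v \<in> U \<and> v \<le> u" u "\<lambda>v. sum v UNIV"] \<open>u \<in> U\<close>
    unfolding m_def by simp_all
  have "v = m" if v: "v \<in> U" "v \<le> m" for v
  proof (rule ccontr)
    assume "v \<noteq> m"
    then obtain i where "v i < m i"
      using v(2) by (metis le_funI leI order_antisym)
    then have "sum v UNIV < sum m UNIV"
      using v(2) by (intro sum_strict_mono_ex1) (auto simp: le_funD)
    then show False
      using min[OF v(1) order_trans[OF v(2) m(2)]] by simp
  qed
  then show "\<exists>m\<in>M. m \<le> u" using m unfolding M_def by blast
qed

section \<open>Polytope plus finitely generated cone\<close>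

lemma polyhedron_affine_slice:
  fixes S :: "('a::euclidean_space \<times> 'b::euclidean_space) set"
  assumes "polyhedron S"
  shows "polyhedron {x. (x, c) \<in> S}"
proof -
  obtain F where F: "finite F" "S = \<Inter>F" "\<And>h. h \<in> F \<Longrightarrow> \<exists>a b. h = {x. a \<bullet> x \<le> b}"
    using assms unfolding polyhedron_def by metis
  have "polyhedron {x. (x, c) \<in> h}" if h: "h \<in> F" for h
  proof -
    obtain a b where "h = {x. a \<bullet> x \<le> b}" using F(3)[OF h] by blast
    \<comment> \<open>\<open>fst a\<close> may be zero; the slice is then empty or the whole space,
      still a polyhedron.\<close>
    then have "{x. (x, c) \<in> h} = {x. fst a \<bullet> x \<le> b - snd a \<bullet> c}"
      by (auto simp: inner_prod_def)
    then show ?thesis by (simp add: polyhedron_halfspace_le)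
  qed
  then have "polyhedron (\<Inter>h\<in>F. {x. (x, c) \<in> h})"
    using F(1) by (intro polyhedron_Inter) auto
  moreover have "(\<Inter>h\<in>F. {x. (x, c) \<in> h}) = {x. (x, c) \<in> S}" using F(2) by auto
  ultimately show ?thesis by simp
qed

lemma polyhedron_convex_hull_plus_convex_cone_hull:
  fixes S T :: "'a::euclidean_space set"
  assumes "finite S" "finite T"
  shows "polyhedron {x + y |x y. x \<in> convex hull S \<and> y \<in> convex_cone hull T}"
proof (cases "S = {}")
  case False
  \<comment> \<open>homogenization: the set is the slice at height 1 of a finitely generated cone\<close>
  define C where "C = convex_cone hull (S \<times> {1::real} \<union> (\<lambda>y. (y, 0)) ` T)"
  have "linear (\<lambda>y::'a. (y, 0::real))"
    by (simp add: linear_iff)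
  then have "convex_cone hull ((\<lambda>y. (y, 0::real)) ` T) = (\<lambda>y. (y, 0)) ` (convex_cone hull T)"
    by (rule convex_cone_hull_linear_image)
  moreover have "convex_cone hull (S \<times> {1::real})
      = (\<Union>x\<in>convex hull S. \<Union>c\<in>{0..}. {(c *\<^sub>R x, c)})"
    using False by (auto simp: convex_cone_hull_convex_hull_nonempty convex_hull_Times)
  \<comment> \<open>Generators from \<open>T\<close> have height 0, so height 1 forces the scale
    \<open>c\<close> of the other summand to be 1.\<close>
  ultimately have "{x + y |x y. x \<in> convex hull S \<and> y \<in> convex_cone hull T} = {x. (x, 1) \<in> C}"
    unfolding C_def convex_cone_hull_Un by auto
  moreover have "polyhedron C"
    unfolding C_def using assms by (intro polyhedron_convex_cone_hull) auto
  ultimately show ?thesis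
    by (simp add: polyhedron_affine_slice)
qed simp

text \<open>Expansion in the basis shows that the orthant is finitely generated, so it can serve as
  the cone in the preceding lemma.\<close>

lemma convex_cone_hull_Basis:
  "convex_cone hull Basis = {x :: 'a::ordered_euclidean_space. 0 \<le> x}"
proof (rule hull_unique)
  show "Basis \<subseteq> {x :: 'a. 0 \<le> x}"
    by (auto simp: eucl_le[where 'a='a] inner_Basis)
  show "convex_cone {x :: 'a. 0 \<le> x}"
    by (simp add: convex_cone_iff eucl_le[where 'a='a] inner_simps)
  fix T :: "'a set"
  assume T: "Basis \<subseteq> T" "convex_cone T"
  have "(\<Sum>b\<in>B. (x \<bullet> b) *\<^sub>R b) \<in> T" if "0 \<le> x" "B \<subseteq> Basis" for x and B :: "'a set"
    using finite_subset[OF that(2) finite_Basis] that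
  proof induction
    case (insert b B)
    then show ?case
      using T by (auto intro!: convex_cone_add convex_cone_scaleR simp: eucl_le[where 'a='a])
  qed (use T convex_cone_contains_0 in auto)
  from this[of _ Basis] show "{x. 0 \<le> x} \<subseteq> T"
    by (auto simp: euclidean_representation)
qed

section \<open>Hulls of up-closed sets of natural points\<close>

definition nat_points :: "(real ^ 'n) set" where
  "nat_points = {x. \<forall>i. x $ i \<in> \<nat>}"

definition upper_nat_set :: "(real ^ 'n) set \<Rightarrow> bool" where
  "upper_nat_set U \<longleftrightarrow> U \<subseteq> nat_points \<and> (\<forall>u\<in>U. \<forall>v\<in>nat_points. u \<le> v \<longrightarrow> v \<in> U)"

lemma upper_nat_setD: "upper_nat_set U \<Longrightarrow> u \<in> U \<Longrightarrow> v \<in> nat_points \<Longrightarrow> u \<le> v \<Longrightarrow> v \<in> U"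
  by (auto simp: upper_nat_set_def)

lemma upper_nat_set_subset: "upper_nat_set U \<Longrightarrow> U \<subseteq> nat_points"
  by (auto simp: upper_nat_set_def)

lemma nat_points_nonneg: "x \<in> nat_points \<Longrightarrow> 0 \<le> x"
  by (auto simp: nat_points_def less_eq_vec_def Nats_altdef2)

lemma finite_bounded_nat_points:
  fixes K :: "'n::finite \<Rightarrow> real"
  shows "finite {x \<in> nat_points :: (real ^ 'n) set. \<forall>i. x $ i \<le> K i}"
proof -
  have "{x \<in> nat_points :: (real ^ 'n) set. \<forall>i. x $ i \<le> K i}
      \<subseteq> (\<lambda>f. \<chi> i. real (f i)) ` (PiE UNIV (\<lambda>i. {..nat \<lceil>K i\<rceil>}))"
  proof
    fix x :: "real ^ 'n"
    assume x: "x \<in> {x \<in> nat_points. \<forall>i. x $ i \<le> K i}"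
    then have "\<forall>i. \<exists>k. x $ i = real k"
      by (auto simp: nat_points_def Nats_def)
    then obtain f where f: "\<And>i. x $ i = real (f i)" by metis
    have "f i \<le> nat \<lceil>K i\<rceil>" for i
    proof -
      have "x $ i \<le> K i" using x by simp
      then show ?thesis unfolding f by linarith
    qed
    moreover have "x = (\<chi> i. real (f i))" by (simp add: vec_eq_iff f)
    ultimately show "x \<in> (\<lambda>f. \<chi> i. real (f i)) ` (PiE UNIV (\<lambda>i. {..nat \<lceil>K i\<rceil>}))"
      by auto
  qed
  then show ?thesis
    by (rule finite_subset) (auto intro!: finite_PiE)
qed

text \<open>The set \<open>R\<close> of admissible translations contains the natural points by
  up-closedness, then the nonnegative multiples of unit vectors by convexity, then their
  sums.\<close>

lemma convex_hull_upper_nat_set_add: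
  assumes U: "upper_nat_set U" and x: "x \<in> convex hull U" and y: "0 \<le> y"
  shows "x + y \<in> convex hull U"
proof -
  define R where "R = {y. \<forall>x \<in> convex hull U. x + y \<in> convex hull U}"
  have nat: "y \<in> R" if "y \<in> nat_points" for y
  proof -
    have "(\<lambda>x. y + x) ` U \<subseteq> U"
      using that upper_nat_setD[OF U] upper_nat_set_subset[OF U] nat_points_nonneg[OF that]
      by (fastforce simp: nat_points_def)
    then have "convex hull ((\<lambda>x. y + x) ` U) \<subseteq> convex hull U"
      by (rule hull_mono)
    then show ?thesis
      unfolding convex_hull_translation R_def by (auto simp: add.commute)
  qed
  have scale: "t *\<^sub>R axis i 1 \<in> R" if "0 \<le> t" for t and i :: 'a
  proof -
    obtain N :: nat where N: "t < N" using reals_Archimedean2 by blast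
    have "real N *\<^sub>R axis i 1 \<in> nat_points" by (simp add: nat_points_def axis_def)
    then have "z + real N *\<^sub>R axis i 1 \<in> convex hull U" if "z \<in> convex hull U" for z
      using nat that unfolding R_def by blast
    \<comment> \<open>Moving by \<open>t\<close> along an axis reaches the fraction
      \<open>t / N\<close> of the segment to the integral translate.\<close>
    then have "(1 - t / N) *\<^sub>R z + (t / N) *\<^sub>R (z + real N *\<^sub>R axis i 1) \<in> convex hull U"
      if "z \<in> convex hull U" for z
      using that N \<open>0 \<le> t\<close> by (intro convexD_alt) auto
    then show ?thesis
      using N \<open>0 \<le> t\<close> unfolding R_def by (simp add: algebra_simps)
  qed
  have add: "a + b \<in> R" if "a \<in> R" "b \<in> R" for a b
    using that unfolding R_def by (simp flip: add.assoc)
  have sum: "(\<Sum>i\<in>I. (y $ i) *\<^sub>R axis i 1) \<in> R" if "finite I" for I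
    using that
  proof induction
    case empty
    then show ?case by (simp add: R_def)
  next
    case (insert i I)
    then show ?case using y by (auto intro!: add scale simp: less_eq_vec_def)
  qed
  have "(\<Sum>i\<in>UNIV. (y $ i) *\<^sub>R axis i 1) = y"
    using basis_expansion[of y] by (simp add: scalar_mult_eq_scaleR)
  then have "y \<in> R" using sum[of UNIV] by simp
  then show ?thesis using x by (simp add: R_def)
qed

lemma finite_minimal_nat_points:
  fixes U :: "(real ^ 'n) set"
  assumes "U \<subseteq> nat_points"
  shows "\<exists>M\<subseteq>U. finite M \<and> (\<forall>u\<in>U. \<exists>m\<in>M. m \<le> u)"
proof -
  define e where "e f = (\<chi> i. real (f i) :: real ^ 'n)" for f :: "'n \<Rightarrow> nat"
  obtain M where M: "M \<subseteq> {f. e f \<in> U}" "finite M" "\<And>f. e f \<in> U \<Longrightarrow> \<exists>m\<in>M. m \<le> f"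
    using finite_minimal_nat_fun[of "{f. e f \<in> U}"] by auto
  have "\<exists>m\<in>e ` M. m \<le> u" if u: "u \<in> U" for u
  proof -
    have "\<forall>i. \<exists>k. u $ i = real k"
      using u assms by (auto simp: nat_points_def Nats_def)
    then obtain f where f: "u = e f"
      unfolding e_def vec_eq_iff by (metis vec_lambda_beta)
    then obtain m where "m \<in> M" "m \<le> f" using M(3) u by blast
    then show ?thesis
      unfolding f by (auto simp: e_def less_eq_vec_def le_fun_def)
  qed
  then show ?thesis
    using M by (intro exI[of _ "e ` M"]) auto
qed

text \<open>Each point of \<open>U\<close> is a minimal one plus a nonnegative vector, and adding
  such vectors does not leave the hull.\<close>

lemma polyhedron_convex_hull_upper_nat_set:
  assumes U: "upper_nat_set U"
  shows "polyhedron (convex hull U)"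
proof -
  obtain M where M: "M \<subseteq> U" "finite M" "\<And>u. u \<in> U \<Longrightarrow> \<exists>m\<in>M. m \<le> u"
    using finite_minimal_nat_points[OF upper_nat_set_subset[OF U]] by auto
  let ?P = "{x + y |x y. x \<in> convex hull M \<and> y \<in> convex_cone hull Basis}"
  have "polyhedron ?P"
    using M(2) by (intro polyhedron_convex_hull_plus_convex_cone_hull) auto
  moreover have "?P = convex hull U"
  proof
    show "?P \<subseteq> convex hull U"
      using convex_hull_upper_nat_set_add[OF U] hull_mono[OF M(1)]
      by (auto simp: convex_cone_hull_Basis)
    have "U \<subseteq> ?P"
    proof
      fix u assume "u \<in> U"
      then obtain m where "m \<in> M" "m \<le> u" using M(3) by blast
      then have "m \<in> convex hull M \<and> u - m \<in> convex_cone hull Basis \<and> u = m + (u - m)"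
        by (simp add: hull_inc convex_cone_hull_Basis)
      then show "u \<in> ?P" by blast
    qed
    then show "convex hull U \<subseteq> ?P"
      using polyhedron_imp_convex[OF \<open>polyhedron ?P\<close>] by (rule hull_minimal)
  qed
  ultimately show ?thesis by simp
qed

section \<open>Separation with a finite witness\<close>

text \<open>A separating functional is nonnegative because the hull is closed under adding
  nonnegative vectors; a small multiple of the all-ones vector then makes it strictly
  positive.\<close>

lemma separating_positive_functional:
  assumes U: "upper_nat_set U" and x: "x \<notin> convex hull U"
  obtains c b where "\<And>i. 0 < c $ i" "c \<bullet> x < b" "\<And>u. u \<in> U \<Longrightarrow> b \<le> c \<bullet> u"
proof (cases "U = {}")
  case True
  then show ?thesis by (intro that[of 1 "1 \<bullet> x + 1"]) auto
next
  case False
  then obtain u where u: "u \<in> U" by blast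
  have "convex (convex hull U)" "closed (convex hull U)"
    using polyhedron_convex_hull_upper_nat_set[OF U] polyhedron_imp_closed by auto
  from separating_hyperplane_closed_point[OF this x]
  obtain a b where ab: "a \<bullet> x < b" "\<And>y. y \<in> convex hull U \<Longrightarrow> b < a \<bullet> y"
    by blast
  have "0 \<le> a $ i" for i
  proof (rule ccontr)
    assume neg: "\<not> 0 \<le> a $ i"
    \<comment> \<open>With this \<open>t\<close> the functional takes exactly the value
      \<open>b\<close> at \<open>u + t *\<^sub>R axis i 1\<close>, against strict
      separation.\<close>
    define t where "t = (a \<bullet> u - b) / - (a $ i)"
    have "b < a \<bullet> u" using ab(2) u by (simp add: hull_inc)
    then have "0 \<le> t" using neg by (simp add: t_def divide_simps)
    then have "u + t *\<^sub>R axis i 1 \<in> convex hull U"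
      using u by (intro convex_hull_upper_nat_set_add[OF U]) (auto simp: hull_inc less_eq_vec_def axis_def)
    from ab(2)[OF this] have "b < a \<bullet> u + t * a $ i"
      by (simp add: inner_right_distrib inner_axis)
    then show False using neg by (simp add: t_def)
  qed
  \<comment> \<open>The perturbation raises the value at \<open>x\<close> by at most half the gap
    \<open>b - a \<bullet> x\<close>; the \<open>+ 1\<close> keeps the denominator positive.\<close>
  define e where "e = (b - a \<bullet> x) / (2 * (\<bar>1 \<bullet> x\<bar> + 1))"
  have e: "0 < e" using ab(1) by (simp add: e_def)
  show ?thesis
  proof (rule that[of "a + e *\<^sub>R 1" b])
    show "0 < (a + e *\<^sub>R 1) $ i" for i
      using e \<open>0 \<le> a $ i\<close> by simp
    have "e * (1 \<bullet> x) \<le> e * (\<bar>1 \<bullet> x\<bar> + 1)" using e by (intro mult_left_mono) auto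
    also have "\<dots> = (b - a \<bullet> x) / 2" by (simp add: e_def field_simps)
    finally show "(a + e *\<^sub>R 1) \<bullet> x < b"
      using ab(1) by (simp add: inner_left_distrib)
    fix u assume u: "u \<in> U"
    have "0 \<le> (1 :: real ^ 'a) \<bullet> u"
      using nat_points_nonneg[of u] u upper_nat_set_subset[OF U]
      by (auto simp: inner_vec_def less_eq_vec_def intro!: sum_nonneg)
    then have "0 \<le> e * (1 \<bullet> u)" using e by simp
    moreover have "b < a \<bullet> u" using ab(2) u by (simp add: hull_inc)
    ultimately show "b \<le> (a + e *\<^sub>R 1) \<bullet> u"
      by (simp add: inner_left_distrib)
  qed
qed

text \<open>\<open>B\<close> collects the natural points on the side of \<open>x\<close>. As
  \<open>U\<close> misses \<open>B\<close>, so does \<open>V\<close>, and the same hyperplane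
  separates \<open>x\<close> from \<open>V\<close>.\<close>

lemma finite_witness_notin_convex_hull:
  assumes U: "upper_nat_set U" and x: "x \<notin> convex hull U"
  obtains B where "finite B" "\<And>V. V \<subseteq> nat_points \<Longrightarrow> V \<inter> B = U \<inter> B \<Longrightarrow> x \<notin> convex hull V"
proof -
  obtain c b where c: "\<And>i. 0 < c $ i" and x: "c \<bullet> x < b" and b: "\<And>u. u \<in> U \<Longrightarrow> b \<le> c \<bullet> u"
    using separating_positive_functional[OF assms] by blast
  define B where "B = {p \<in> nat_points. c \<bullet> p < b}"
  have bound: "p $ i \<le> b / c $ i" if p: "p \<in> nat_points" "c \<bullet> p < b" for p i
  proof -
    \<comment> \<open>One term of a sum of nonnegative terms is at most the sum, so strict
      positivity of \<open>c\<close> bounds each coordinate.\<close>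
    have "c $ i * p $ i \<le> (\<Sum>j\<in>UNIV. c $ j * p $ j)"
      using c nat_points_nonneg[OF p(1)]
      by (intro member_le_sum) (auto simp: less_eq_vec_def less_imp_le)
    also have "\<dots> < b" using p(2) by (simp add: inner_vec_def)
    finally show ?thesis
      using c[of i] by (simp add: field_simps)
  qed
  have "finite B"
    by (rule finite_subset[OF _ finite_bounded_nat_points[of "\<lambda>i. b / c $ i"]])
      (use bound in \<open>auto simp: B_def\<close>)
  moreover have "x \<notin> convex hull V" if V: "V \<subseteq> nat_points" "V \<inter> B = U \<inter> B" for V
  proof -
    have "V \<subseteq> {y. b \<le> c \<bullet> y}"
    proof
      fix v assume "v \<in> V"
      show "v \<in> {y. b \<le> c \<bullet> y}"
      proof (rule ccontr)
        assume "v \<notin> {y. b \<le> c \<bullet> y}"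
        then have "c \<bullet> v < b" by simp
        then have "v \<in> B" using \<open>v \<in> V\<close> V(1) unfolding B_def by blast
        then have "v \<in> U" using V(2) \<open>v \<in> V\<close> by blast
        then show False using b[of v] \<open>c \<bullet> v < b\<close> by simp
      qed
    qed
    from hull_minimal[OF this, of convex] have "convex hull V \<subseteq> {y. b \<le> c \<bullet> y}"
      by (simp add: convex_halfspace_ge)
    then show ?thesis using x by auto
  qed
  ultimately show ?thesis using that by blast
qed

section \<open>Reduction to finitely many hulls\<close>

theorem polyhedron_Inter_convex_hull_upper_nat_sets:
  fixes \<F> :: "(real ^ 'n) set set"
  assumes \<F>: "\<And>V. V \<in> \<F> \<Longrightarrow> upper_nat_set V"
  shows "polyhedron (\<Inter>V\<in>\<F>. convex hull V)"
proof -
  define L where "L = {W. \<forall>B. finite B \<longrightarrow> (\<exists>V\<in>\<F>. V \<inter> B = W \<inter> B)}"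
  have agree: "\<exists>V\<in>\<F>. V \<inter> B = W \<inter> B" if "W \<in> L" "finite B" for W B
    using that by (simp add: L_def)
  \<comment> \<open>Up-closedness constrains at most two points at a time, so it passes to
    limits.\<close>
  have upper: "upper_nat_set W" if W: "W \<in> L" for W
    unfolding upper_nat_set_def
  proof (intro conjI subsetI ballI impI)
    fix u assume u: "u \<in> W"
    obtain V where V: "V \<in> \<F>" "V \<inter> {u} = W \<inter> {u}"
      using agree[OF W, of "{u}"] by auto
    then have "u \<in> V" using u by blast
    then show "u \<in> nat_points" using upper_nat_set_subset[OF \<F>[OF V(1)]] by blast
  next
    fix u v assume uv: "u \<in> W" "v \<in> nat_points" "u \<le> v"
    obtain V where V: "V \<in> \<F>" "V \<inter> {u, v} = W \<inter> {u, v}"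
      using agree[OF W, of "{u, v}"] by auto
    then have "u \<in> V" using uv(1) by blast
    then have "v \<in> V" using upper_nat_setD[OF \<F>[OF V(1)]] uv(2,3) by blast
    then show "v \<in> W" using V(2) by blast
  qed
  have limit: "(\<Inter>V\<in>\<F>. convex hull V) \<subseteq> convex hull W" if W: "W \<in> L" for W
  proof (rule subsetI, rule ccontr)
    fix x assume x: "x \<in> (\<Inter>V\<in>\<F>. convex hull V)" "x \<notin> convex hull W"
    obtain B where "finite B"
      and B: "\<And>V. V \<subseteq> nat_points \<Longrightarrow> V \<inter> B = W \<inter> B \<Longrightarrow> x \<notin> convex hull V"
      using finite_witness_notin_convex_hull[OF upper[OF W] x(2)] by metis
    obtain V where V: "V \<in> \<F>" "V \<inter> B = W \<inter> B"
      using agree[OF W \<open>finite B\<close>] by blast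
    have "x \<notin> convex hull V"
      by (rule B[OF upper_nat_set_subset[OF \<F>[OF V(1)]] V(2)])
    then show False using x(1) V(1) by blast
  qed
  have "\<exists>M\<subseteq>W. finite M \<and> (\<forall>u\<in>W. \<exists>m\<in>M. m \<le> u)" if "W \<in> L" for W
    by (intro finite_minimal_nat_points upper_nat_set_subset upper that)
  then obtain g where g: "\<And>W. W \<in> L \<Longrightarrow> g W \<subseteq> W" "\<And>W. W \<in> L \<Longrightarrow> finite (g W)"
      "\<And>W u. W \<in> L \<Longrightarrow> u \<in> W \<Longrightarrow> \<exists>m\<in>g W. m \<le> u"
    by metis
  obtain \<G> where \<G>: "finite \<G>" "\<G> \<subseteq> L" "\<And>V. V \<in> \<F> \<Longrightarrow> \<exists>W\<in>\<G>. g W \<subseteq> V"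
    using finite_limit_cover[of \<F> g, folded L_def, OF g(2) g(1)] by blast
  have "convex hull W \<subseteq> convex hull V" if V: "V \<in> \<F>" and W: "W \<in> \<G>" "g W \<subseteq> V" for V W
  proof (rule hull_mono, rule subsetI)
    fix w assume "w \<in> W"
    have "W \<in> L" using W(1) \<G>(2) by blast
    obtain m where "m \<in> g W" "m \<le> w" using g(3)[OF \<open>W \<in> L\<close> \<open>w \<in> W\<close>] by blast
    moreover have "w \<in> nat_points"
      using \<open>w \<in> W\<close> upper_nat_set_subset[OF upper[OF \<open>W \<in> L\<close>]] by blast
    ultimately show "w \<in> V" using upper_nat_setD[OF \<F>[OF V]] W(2) by blast
  qed
  then have "\<exists>W\<in>\<G>. convex hull W \<subseteq> convex hull V" if "V \<in> \<F>" for V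
    using \<G>(3) that by meson
  \<comment> \<open>Members of \<open>\<G>\<close> are limits and may lie outside
    \<open>\<F>\<close>: this inclusion comes from the cover, the reverse one from
    \<open>limit\<close>.\<close>
  then have "(\<Inter>W\<in>\<G>. convex hull W) \<subseteq> (\<Inter>V\<in>\<F>. convex hull V)"
    by (intro INF_mono)
  moreover have "(\<Inter>V\<in>\<F>. convex hull V) \<subseteq> (\<Inter>W\<in>\<G>. convex hull W)"
    using limit \<G>(2) by (intro INF_greatest) blast
  ultimately have "(\<Inter>V\<in>\<F>. convex hull V) = (\<Inter>W\<in>\<G>. convex hull W)"
    by blast
  moreover have "polyhedron (\<Inter>W\<in>\<G>. convex hull W)"
    using \<G> by (intro polyhedron_Inter) (auto intro!: polyhedron_convex_hull_upper_nat_set upper)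
  ultimately show ?thesis by simp
qed

section \<open>Application to aggregations\<close>

text \<open>The aggregated matrix has nonnegative entries, so enlarging a point preserves every
  aggregated covering inequality.\<close>

lemma upper_nat_set_aggregated:
  fixes A :: "real ^ 'n ^ 'm" and b :: "real ^ 'm" and \<Lambda> :: "real ^ 'k ^ 'm"
  assumes A: "\<And>i j. 0 \<le> A $ i $ j" and \<Lambda>: "\<And>i l. 0 \<le> \<Lambda> $ i $ l"
  shows "upper_nat_set (aggregated_polyhedron A b \<Lambda> \<inter> integer_points)"
proof -
  have mono: "(transpose \<Lambda> ** A) *v u \<le> (transpose \<Lambda> ** A) *v v" if "u \<le> v" for u v
    using that A \<Lambda>
    by (auto simp: less_eq_vec_def matrix_vector_mult_def matrix_matrix_mult_def transpose_def
        intro!: sum_mono mult_left_mono sum_nonneg)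
  show ?thesis
    unfolding upper_nat_set_def
  proof (intro conjI ballI impI)
    show "aggregated_polyhedron A b \<Lambda> \<inter> integer_points \<subseteq> nat_points"
      by (auto simp: aggregated_polyhedron_def covering_polyhedron_def integer_points_def
          nat_points_def less_eq_vec_def Nats_altdef2)
    fix u v
    assume u: "u \<in> aggregated_polyhedron A b \<Lambda> \<inter> integer_points" and v: "v \<in> nat_points" "u \<le> v"
    have "v \<in> integer_points"
      using v(1) Nats_subset_Ints by (auto simp: nat_points_def integer_points_def)
    then show "v \<in> aggregated_polyhedron A b \<Lambda> \<inter> integer_points"
      using u order_trans[OF _ mono[OF v(2)]] nat_points_nonneg[OF v(1)]
      by (simp add: aggregated_polyhedron_def covering_polyhedron_def)
  qed
qed

theorem theorem4:
  fixes A :: "real ^ 'n ^ 'm" and b :: "real ^ 'm"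
  assumes "\<And>i j. A $ i $ j \<in> \<int>" and "\<And>i. b $ i \<in> \<int>"
    and "\<And>i j. A $ i $ j \<ge> 0" and "\<And>i. b $ i > 0"
  shows "polyhedron (aggregation_closure TYPE('k::finite) A b)"
proof -
  define \<F> where "\<F> = (\<lambda>\<Lambda> :: real ^ 'k ^ 'm. aggregated_polyhedron A b \<Lambda> \<inter> integer_points)
    ` {\<Lambda>. \<forall>i l. 0 \<le> \<Lambda> $ i $ l}"
  have "aggregation_closure TYPE('k) A b = (\<Inter>V\<in>\<F>. convex hull V)"
    unfolding aggregation_closure_def \<F>_def by simp
  also have "polyhedron \<dots>"
    using upper_nat_set_aggregated assms(3)
    by (intro polyhedron_Inter_convex_hull_upper_nat_sets) (auto simp: \<F>_def)
  finally show ?thesis .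
qed

end
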